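(* Let $(n_m)_{m\ge0}$ be a monotone increasing sequence of non-negative integers (i.e. $n_m\le n_{m+1}$ for all $m\geq 0$) and, for each prime $q$, let $(\mathbb{F}_q^{n_m},A_m)$ be a uniform random chain complex over $\mathbb{F}_q$ with $m$-th Betti number $\beta_m$. Then for every $m\ge0$, \[ \lim_{q\to\infty}\mathbb{P}[\beta_m=0]=1, \] where the limit is over primes $q$.
   Context: Uniform random chain complex: given a prime $q$ and non-negative integers $(n_m)_{m\ge0}$, it is a random sequence of matrices $A_m$ over $\mathbb{F}_q$ ($m\ge 0$), where $A_m$ has size $n_{m-1}\times n_m$ for $m\geq 1$ and is regarded as a linear map $\mathbb{F}_q^{n_m}\to\mathbb{F}_q^{n_{m-1}}$, and $A_0:\mathbb{F}_q^{n_0}\to 0$ is the zero map. The matrices are chosen successively: for each $m\ge0$, given $A_0,\dots,A_m$, the matrix $A_{m+1}$ is uniformly distributed over all $n_m\times n_{m+1}$ matrices over $\mathbb{F}_q$ satisfying $A_mA_{m+1}=0$ (i.e. entries i.i.d. uniform on $\mathbb{F}_q$, conditioned on $A_mA_{m+1}=0$). Betti number: $\beta_m=\operatorname{nul}(A_m)-\operatorname{rank}(A_{m+1})=\dim_{\mathbb{F}_q}(\ker A_m/\operatorname{im}A_{m+1})$, where $\operatorname{nul}$ denotes the dimension of the kernel. *)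

theory Defs
  imports
    "HOL-Probability.Probability"
    "HOL-Number_Theory.Residues"
    "Jordan_Normal_Form.Missing_VectorSpace"
begin

text \<open>
  The statement takes a limit over primes, so the field has to be a value and not a type: the field
  with \<open>q\<close> elements is the record \<open>residue_ring (int q)\<close>. An \<open>r \<times> c\<close> matrix over \<open>K\<close> is an
  extensional function on index pairs (row, column), counted from 0, with values in \<open>carrier K\<close>.
\<close>

abbreviation coord_space :: "('a, 'b) ring_scheme \<Rightarrow> nat \<Rightarrow> ('a, nat \<Rightarrow> 'a) module" where
  "coord_space K n \<equiv> ring.func_space K {..<n}"

abbreviation matrix_space ::
  "('a, 'b) ring_scheme \<Rightarrow> nat \<Rightarrow> nat \<Rightarrow> ('a, nat \<times> nat \<Rightarrow> 'a) module" where
  "matrix_space K r c \<equiv> ring.func_space K ({..<r} \<times> {..<c})"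

definition matrix_map ::
  "('a, 'b) ring_scheme \<Rightarrow> nat \<Rightarrow> nat \<Rightarrow> (nat \<times> nat \<Rightarrow> 'a) \<Rightarrow> (nat \<Rightarrow> 'a) \<Rightarrow> (nat \<Rightarrow> 'a)" where
  "matrix_map K r c X v = (\<lambda>i\<in>{..<r}. \<Oplus>\<^bsub>K\<^esub>l\<in>{..<c}. X (i, l) \<otimes>\<^bsub>K\<^esub> v l)"

definition matrix_mult ::
  "('a, 'b) ring_scheme \<Rightarrow> nat \<Rightarrow> nat \<Rightarrow> nat \<Rightarrow> (nat \<times> nat \<Rightarrow> 'a) \<Rightarrow> (nat \<times> nat \<Rightarrow> 'a) \<Rightarrow> (nat \<times> nat \<Rightarrow> 'a)" where
  "matrix_mult K r k c X Y =
     (\<lambda>(i, j)\<in>{..<r} \<times> {..<c}. \<Oplus>\<^bsub>K\<^esub>l\<in>{..<k}. X (i, l) \<otimes>\<^bsub>K\<^esub> Y (l, j))"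

definition matrix_nullity :: "('a, 'b) ring_scheme \<Rightarrow> nat \<Rightarrow> nat \<Rightarrow> (nat \<times> nat \<Rightarrow> 'a) \<Rightarrow> nat" where
  "matrix_nullity K r c X = vectorspace.dim K
     (coord_space K c\<lparr>carrier := mod_hom.ker (coord_space K c) (coord_space K r) (matrix_map K r c X)\<rparr>)"

definition matrix_rank :: "('a, 'b) ring_scheme \<Rightarrow> nat \<Rightarrow> nat \<Rightarrow> (nat \<times> nat \<Rightarrow> 'a) \<Rightarrow> nat" where
  "matrix_rank K r c X = vectorspace.dim K
     (coord_space K r\<lparr>carrier := mod_hom.im (coord_space K c) (matrix_map K r c X)\<rparr>)"

text \<open>The number of rows of the \<open>m\<close>-th matrix; the \<open>0\<close>-th one maps to the zero space.\<close>

definition target_dim :: "(nat \<Rightarrow> nat) \<Rightarrow> nat \<Rightarrow> nat" where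
  "target_dim n m = (case m of 0 \<Rightarrow> 0 | Suc k \<Rightarrow> n k)"

definition betti ::
  "('a, 'b) ring_scheme \<Rightarrow> (nat \<Rightarrow> nat) \<Rightarrow> (nat \<Rightarrow> nat \<times> nat \<Rightarrow> 'a) \<Rightarrow> nat \<Rightarrow> int" where
  "betti K n X m = int (matrix_nullity K (target_dim n m) (n m) (X m))
     - int (matrix_rank K (n m) (n (Suc m)) (X (Suc m)))"

definition annihilated_matrices ::
  "('a, 'b) ring_scheme \<Rightarrow> (nat \<Rightarrow> nat) \<Rightarrow> nat \<Rightarrow> (nat \<times> nat \<Rightarrow> 'a) \<Rightarrow> (nat \<times> nat \<Rightarrow> 'a) set" where
  "annihilated_matrices K n m X = {Y \<in> carrier (matrix_space K (n m) (n (Suc m))).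
     matrix_mult K (target_dim n m) (n m) (n (Suc m)) X Y
       = \<zero>\<^bsub>matrix_space K (target_dim n m) (n (Suc m))\<^esub>}"

text \<open>
  The matrices are random variables on an arbitrary probability space. Being chosen successively
  and uniformly is a condition on conditional probabilities given the whole past. No condition on
  \<open>A 0\<close> is needed beyond its size: there is only one matrix without rows.
\<close>

locale uniform_random_chain_complex = prob_space M
  for q :: nat and n :: "nat \<Rightarrow> nat" and M :: "'w measure"
    and A :: "nat \<Rightarrow> 'w \<Rightarrow> nat \<times> nat \<Rightarrow> int" +
  assumes prime_q: "prime q"
    and random_matrix: "\<And>m. random_variable
      (count_space (carrier (matrix_space (residue_ring (int q)) (target_dim n m) (n m)))) (A m)"
    and uniform: "\<And>m a b. \<P>(\<omega> in M. \<forall>i\<le>m. A i \<omega> = a i) > 0 \<Longrightarrow>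
      \<P>(\<omega> in M. A (Suc m) \<omega> = b \<bar> \<forall>i\<le>m. A i \<omega> = a i)
        = pmf (pmf_of_set (annihilated_matrices (residue_ring (int q)) n m (a m))) b"

end

(*
  Given A_m, put V = ker A_m; the columns of A_{m+1} are independent and uniform in V. Once the
  image of A_{m+1} equals V as a set, the Betti number vanishes, so no dimension theory is needed.
  Count the pairs (Y, u) with Y in the set W of matrices annihilated by A_m, u a vector of length
  N = n_{m+1}, and Y u = 0. For u nonzero, Y u takes every value in V equally often, so there are
  at most |W| + (q^N - 1) |W| / |V| pairs. On the other hand |ker Y| = q^N / |im Y| is at least
  q^N / |V|, and at least q^{N+1} / |V| if im Y is a proper subspace of V. Since
  |V| <= q^{n_m} <= q^N, comparing the two bounds shows that the proportion of Y in W with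
  im Y different from V is at most 1 / (q - 1).
*)
theory Submission
  imports Defs "HOL-Real_Asymp.Real_Asymp"
begin

section \<open>Function spaces and congruence of finite sums\<close>

lemma (in ring) func_space_simps [simp]:
  "carrier (func_space S) = S \<rightarrow>\<^sub>E carrier R"
  "\<zero>\<^bsub>func_space S\<^esub> = (\<lambda>i\<in>S. \<zero>)"
  "x \<oplus>\<^bsub>func_space S\<^esub> y = (\<lambda>i\<in>S. x i \<oplus> y i)"
  "a \<odot>\<^bsub>func_space S\<^esub> x = (\<lambda>i\<in>S. a \<otimes> x i)"
  by (simp_all add: func_space_def)

(* Without the closure side condition of finprod_cong, these serve as congruence rules for the
   simplifier even where the terms still contain the undefined values of restrict. *)
lemma finprod_cong_strong:
  assumes "A = B" "\<And>i. i \<in> B =simp=> f i = g i"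
  shows "finprod G f A = finprod G g B"
proof -
  \<comment> \<open>\<open>foldSetD\<close> evaluates the function only at elements of the set being
    folded, so agreement on \<open>B\<close> transfers every derivation. With \<open>f'\<close> and
    \<open>g'\<close> general, the fact serves for both directions of the equivalence.\<close>
  have *: "(C, y) \<in> foldSetD D (mult G \<circ> g') e"
    if "(C, y) \<in> foldSetD D (mult G \<circ> f') e" "C \<subseteq> B" "\<And>i. i \<in> B \<Longrightarrow> f' i = g' i"
    for C y D e and f' g' :: "'a \<Rightarrow> 'b"
    using that
  proof (induction rule: foldSetD.induct)
    case emptyI
    then show ?case by (intro foldSetD.emptyI)
  next
    case (insertI x A y)
    then show ?case
      using foldSetD.insertI [of x A "mult G \<circ> g'" y D e] by (auto simp: comp_def)
  qed
  have "(B, y) \<in> foldSetD D (mult G \<circ> f) e \<longleftrightarrow> (B, y) \<in> foldSetD D (mult G \<circ> g) e" for y D e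
    using *[of B y D f e g] *[of B y D g e f] assms(2) by (auto simp: simp_implies_def)
  then show ?thesis
    by (simp add: finprod_def foldD_def assms(1))
qed

lemma finsum_cong_strong:
  "A = B \<Longrightarrow> (\<And>i. i \<in> B =simp=> f i = g i) \<Longrightarrow> finsum G f A = finsum G g B"
  unfolding finsum_def by (rule finprod_cong_strong)

section \<open>Matrices as linear maps over a commutative ring\<close>

text \<open>This is \<open>annihilated_matrices\<close> with the three dimensions as free
  parameters, so that the linear algebra does not refer to the sequence \<open>n\<close>.\<close>

definition (in ring) annihilators where
  "annihilators r k c X = {Y \<in> carrier (matrix_space R k c).
     matrix_mult R r k c X Y = \<zero>\<^bsub>matrix_space R r c\<^esub>}"

context cring
begin

lemma matrix_map_mod_hom:
  assumes "X \<in> carrier (matrix_space R r c)"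
  shows "mod_hom R (coord_space R c) (coord_space R r) (matrix_map R r c X)"
proof -
  have X: "X (i, j) \<in> carrier R" if "i < r" "j < c" for i j
    using assms that by auto
  have "matrix_map R r c X \<in> module_hom R (coord_space R c) (coord_space R r)"
    unfolding module_hom_def
  proof (safe, goal_cases)
    case (1 v)
    then show ?case
      using X by (auto simp: matrix_map_def PiE_mem intro!: finsum_closed)
  next
    case (2 v w)
    have [simp]: "v l \<in> carrier R" "w l \<in> carrier R" if "l < c" for l
      using 2 that by auto
    have "(\<Oplus>l\<in>{..<c}. X (i, l) \<otimes> (v l \<oplus> w l))
        = (\<Oplus>l\<in>{..<c}. X (i, l) \<otimes> v l) \<oplus> (\<Oplus>l\<in>{..<c}. X (i, l) \<otimes> w l)" if "i < r" for i
      using X that by (subst finsum_addf [symmetric]) (auto simp: r_distr simp del: finsum_addf intro!: finsum_cong')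
    then show ?case
      by (auto simp: matrix_map_def fun_eq_iff restrict_def cong: finsum_cong_strong)
  next
    case (3 a v)
    have [simp]: "v l \<in> carrier R" if "l < c" for l
      using 3 that by auto
    have "(\<Oplus>l\<in>{..<c}. X (i, l) \<otimes> (a \<otimes> v l)) = a \<otimes> (\<Oplus>l\<in>{..<c}. X (i, l) \<otimes> v l)"
      if "i < r" for i
      using X that 3 by (subst finsum_rdistr) (auto simp: m_lcomm intro!: finsum_cong')
    then show ?case
      by (auto simp: matrix_map_def fun_eq_iff restrict_def cong: finsum_cong_strong)
  qed
  then show ?thesis
    by (simp add: mod_hom_def mod_hom_axioms_def func_space_is_module)
qed

text \<open>Both sides are the double sum of \<open>X (i, l)\<close>, \<open>Y (l, j)\<close> and
  \<open>v j\<close>, taken in the two orders of summation.\<close>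

lemma matrix_map_mult:
  assumes X: "X \<in> carrier (matrix_space R r k)" and Y: "Y \<in> carrier (matrix_space R k c)"
    and v: "v \<in> carrier (coord_space R c)"
  shows "matrix_map R r c (matrix_mult R r k c X Y) v
    = matrix_map R r k X (matrix_map R k c Y v)"
proof -
  have [simp]: "X (i, l) \<in> carrier R" if "i < r" "l < k" for i l
    using X that by auto
  have [simp]: "Y (l, j) \<in> carrier R" if "l < k" "j < c" for l j
    using Y that by auto
  have [simp]: "v j \<in> carrier R" if "j < c" for j
    using v that by auto
  have "(\<Oplus>j\<in>{..<c}. (\<Oplus>l\<in>{..<k}. X (i, l) \<otimes> Y (l, j)) \<otimes> v j)
      = (\<Oplus>l\<in>{..<k}. X (i, l) \<otimes> (\<Oplus>j\<in>{..<c}. Y (l, j) \<otimes> v j))" if i: "i < r" for i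
  proof -
    have "(\<Oplus>j\<in>{..<c}. (\<Oplus>l\<in>{..<k}. X (i, l) \<otimes> Y (l, j)) \<otimes> v j)
        = (\<Oplus>j\<in>{..<c}. \<Oplus>l\<in>{..<k}. X (i, l) \<otimes> Y (l, j) \<otimes> v j)"
      using i by (intro finsum_cong') (auto intro!: finsum_closed finsum_ldistr)
    also have "\<dots> = (\<Oplus>l\<in>{..<k}. \<Oplus>j\<in>{..<c}. X (i, l) \<otimes> Y (l, j) \<otimes> v j)"
      using i by (intro finsum_finsum_swap) auto
    also have "\<dots> = (\<Oplus>l\<in>{..<k}. X (i, l) \<otimes> (\<Oplus>j\<in>{..<c}. Y (l, j) \<otimes> v j))"
      using i by (intro finsum_cong')
        (auto intro!: finsum_closed finsum_cong' simp: finsum_rdistr m_assoc)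
    finally show ?thesis .
  qed
  then show ?thesis
    using assms by (auto simp: matrix_map_def matrix_mult_def fun_eq_iff restrict_def
        intro!: finsum_closed cong: finsum_cong_strong)
qed

text \<open>Additivity in the matrix, for a fixed vector: evaluation at a vector respects
  translation of matrices.\<close>

lemma matrix_map_add:
  assumes X: "X \<in> carrier (matrix_space R r c)" and Y: "Y \<in> carrier (matrix_space R r c)"
    and v: "v \<in> carrier (coord_space R c)"
  shows "matrix_map R r c (X \<oplus>\<^bsub>matrix_space R r c\<^esub> Y) v
    = matrix_map R r c X v \<oplus>\<^bsub>coord_space R r\<^esub> matrix_map R r c Y v"
proof -
  have [simp]: "X (i, j) \<in> carrier R" "Y (i, j) \<in> carrier R" if "i < r" "j < c" for i j
    using X Y that by auto
  have [simp]: "v j \<in> carrier R" if "j < c" for j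
    using v that by auto
  have "(\<Oplus>j\<in>{..<c}. (X (i, j) \<oplus> Y (i, j)) \<otimes> v j)
      = (\<Oplus>j\<in>{..<c}. X (i, j) \<otimes> v j) \<oplus> (\<Oplus>j\<in>{..<c}. Y (i, j) \<otimes> v j)" if "i < r" for i
    using that by (subst finsum_addf [symmetric]) (auto simp: l_distr simp del: finsum_addf intro!: finsum_cong')
  then show ?thesis
    by (auto simp: matrix_map_def fun_eq_iff restrict_def cong: finsum_cong_strong)
qed


lemma matrix_map_zero:
  assumes "v \<in> carrier (coord_space R c)"
  shows "matrix_map R r c \<zero>\<^bsub>matrix_space R r c\<^esub> v = \<zero>\<^bsub>coord_space R r\<^esub>"
proof -
  have [simp]: "v j \<in> carrier R" if "j < c" for j
    using assms that by auto
  have "(\<Oplus>j\<in>{..<c}. \<zero> \<otimes> v j) = \<zero>"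
    by (intro add.finprod_one_eqI) auto
  then show ?thesis
    by (auto simp: matrix_map_def fun_eq_iff restrict_def cong: finsum_cong_strong)
qed

lemma ker_matrix_map:
  assumes "X \<in> carrier (matrix_space R r c)"
  shows "mod_hom.ker (coord_space R c) (coord_space R r) (matrix_map R r c X)
    = {v \<in> carrier (coord_space R c). matrix_map R r c X v = \<zero>\<^bsub>coord_space R r\<^esub>}"
  by (rule mod_hom.ker_def [OF matrix_map_mod_hom [OF assms]])

lemma im_matrix_map:
  assumes "X \<in> carrier (matrix_space R r c)"
  shows "mod_hom.im (coord_space R c) (matrix_map R r c X)
    = matrix_map R r c X ` carrier (coord_space R c)"
  by (rule mod_hom.im_def [OF matrix_map_mod_hom [OF assms]])

text \<open>If X Y = 0 then X (Y v) = 0 for every v. Hence exactness can fail only through a proper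
  inclusion.\<close>

lemma annihilators_im_subset_ker:
  assumes X: "X \<in> carrier (matrix_space R r k)" and Y: "Y \<in> annihilators r k c X"
  shows "mod_hom.im (coord_space R c) (matrix_map R k c Y)
    \<subseteq> mod_hom.ker (coord_space R k) (coord_space R r) (matrix_map R r k X)"
proof -
  have Y': "Y \<in> carrier (matrix_space R k c)"
    and XY: "matrix_mult R r k c X Y = \<zero>\<^bsub>matrix_space R r c\<^esub>"
    using Y by (auto simp: annihilators_def)
  interpret Y: mod_hom R "coord_space R c" "coord_space R k" "matrix_map R k c Y"
    by (rule matrix_map_mod_hom [OF Y'])
  show ?thesis
    unfolding ker_matrix_map [OF X] im_matrix_map [OF Y']
  proof safe
    fix v assume v: "v \<in> carrier (coord_space R c)"
    show "matrix_map R k c Y v \<in> carrier (coord_space R k)"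
      using v by (rule Y.f_im)
    show "matrix_map R r k X (matrix_map R k c Y v) = \<zero>\<^bsub>coord_space R r\<^esub>"
      using matrix_map_mult [OF X Y' v] matrix_map_zero [OF v] XY by metis
  qed
qed

text \<open>Closure under addition permits translating by a fixed annihilator when fibres of
  evaluation maps are compared.\<close>

lemma annihilators_add:
  assumes X: "X \<in> carrier (matrix_space R r k)"
    and Y: "Y \<in> annihilators r k c X" "Z \<in> annihilators r k c X"
  shows "Y \<oplus>\<^bsub>matrix_space R k c\<^esub> Z \<in> annihilators r k c X"
proof -
  have [simp]: "X (i, l) \<in> carrier R" if "i < r" "l < k" for i l
    using X that by auto
  have [simp]: "Y (l, j) \<in> carrier R" "Z (l, j) \<in> carrier R" if "l < k" "j < c" for l j
    using Y that by (auto simp: annihilators_def)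
  have "(\<Oplus>l\<in>{..<k}. X (i, l) \<otimes> (Y (l, j) \<oplus> Z (l, j))) = \<zero>" if "i < r" "j < c" for i j
  proof -
    have "(\<Oplus>l\<in>{..<k}. X (i, l) \<otimes> (Y (l, j) \<oplus> Z (l, j)))
        = (\<Oplus>l\<in>{..<k}. X (i, l) \<otimes> Y (l, j)) \<oplus> (\<Oplus>l\<in>{..<k}. X (i, l) \<otimes> Z (l, j))"
      using that
      by (subst finsum_addf [symmetric]) (auto simp: r_distr simp del: finsum_addf intro!: finsum_cong')
    also have "(\<Oplus>l\<in>{..<k}. X (i, l) \<otimes> Y (l, j)) = matrix_mult R r k c X Y (i, j)"
      using that by (simp add: matrix_mult_def)
    also have "(\<Oplus>l\<in>{..<k}. X (i, l) \<otimes> Z (l, j)) = matrix_mult R r k c X Z (i, j)"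
      using that by (simp add: matrix_mult_def)
    finally show ?thesis
      using Y that by (simp add: annihilators_def)
  qed
  then have "matrix_mult R r k c X (Y \<oplus>\<^bsub>matrix_space R k c\<^esub> Z) = \<zero>\<^bsub>matrix_space R r c\<^esub>"
    by (auto simp: matrix_mult_def fun_eq_iff restrict_def cong: finsum_cong_strong)
  moreover have "Y \<oplus>\<^bsub>matrix_space R k c\<^esub> Z \<in> carrier (matrix_space R k c)"
    by auto
  ultimately show ?thesis
    by (simp only: annihilators_def mem_Collect_eq)
qed

text \<open>Guarantees that the set on which the uniform distribution lives is nonempty.\<close>

lemma zero_in_annihilators:
  assumes X: "X \<in> carrier (matrix_space R r k)"
  shows "\<zero>\<^bsub>matrix_space R k c\<^esub> \<in> annihilators r k c X"
proof -
  have [simp]: "X (i, l) \<in> carrier R" if "i < r" "l < k" for i l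
    using X that by auto
  have "(\<Oplus>l\<in>{..<k}. X (i, l) \<otimes> \<zero>) = \<zero>" if "i < r" for i
    using that by (intro add.finprod_one_eqI) auto
  then show ?thesis
    by (auto simp: annihilators_def matrix_mult_def fun_eq_iff restrict_def split: if_splits cong: finsum_cong_strong)
qed

end

section \<open>Counting in finite modules and matrix spaces\<close>

text \<open>Each nonempty fibre of \<open>f\<close> embeds in the kernel by subtraction of one of
  its points, and there are \<open>card im\<close> such fibres.\<close>

lemma (in mod_hom) card_le_card_ker_times_card_im:
  assumes fin: "finite (carrier M)"
  shows "card (carrier M) \<le> card ker * card im"
proof -
  have "card (carrier M) = (\<Sum>y\<in>im. card {x \<in> carrier M. f x = y})"
    using sum.group [OF fin finite_imageI [OF fin], of f f "\<lambda>_. 1::nat"] by (simp add: im_def)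
  also have "\<dots> \<le> (\<Sum>y\<in>im. card ker)"
  proof (rule sum_mono)
    fix y assume "y \<in> im"
    then obtain z where z: "z \<in> carrier M" "y = f z" by (auto simp: im_def)
    have "inj_on (\<lambda>x. x \<ominus>\<^bsub>M\<^esub> z) {x \<in> carrier M. f x = y}"
      using z by (auto simp: inj_on_def a_minus_def)
    moreover have "(\<lambda>x. x \<ominus>\<^bsub>M\<^esub> z) ` {x \<in> carrier M. f x = y} \<subseteq> ker"
      using z by (auto simp: ker_def N.M.r_neg a_minus_def)
    moreover have "finite ker"
      using fin by (simp add: ker_def)
    ultimately show "card {x \<in> carrier M. f x = y} \<le> card ker"
      using card_inj_on_le by blast
  qed
  also have "\<dots> = card ker * card im"
    by simp
  finally show ?thesis .
qed

context field
begin

text \<open>For \<open>v\<close> in \<open>V\<close> but not in \<open>H\<close>, the multiples of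
  \<open>v\<close> lie in pairwise different cosets of \<open>H\<close>, so all the sums t v + h are
  distinct elements of \<open>V\<close>.\<close>

lemma card_proper_submodule:
  assumes H: "submodule R H M" and V: "submodule R V M" and "H \<subset> V"
    and fin: "finite V"
  shows "card (carrier R) * card H \<le> card V"
proof -
  interpret H: submodule R H M by (rule H)
  interpret V: submodule R V M by (rule V)
  interpret M: module R M by (rule H.module)
  obtain v where v: "v \<in> V" "v \<notin> H"
    using \<open>H \<subset> V\<close> by blast
  have [simp]: "v \<in> carrier M" using v V.subset by blast
  have HM: "x \<in> carrier M" if "x \<in> H" for x using that H.subset by blast
  have "inj_on (\<lambda>(t, h). t \<odot>\<^bsub>M\<^esub> v \<oplus>\<^bsub>M\<^esub> h) (carrier R \<times> H)"
  proof (rule inj_onI, clarify)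
    fix t h t' h'
    assume t: "t \<in> carrier R" "t' \<in> carrier R" and h: "h \<in> H" "h' \<in> H"
      and eq: "t \<odot>\<^bsub>M\<^esub> v \<oplus>\<^bsub>M\<^esub> h = t' \<odot>\<^bsub>M\<^esub> v \<oplus>\<^bsub>M\<^esub> h'"
    \<comment> \<open>Otherwise \<open>t \<ominus> t'\<close> is invertible and multiplies
      \<open>v\<close> into \<open>H\<close>; dividing by it puts \<open>v\<close> itself in
      \<open>H\<close>.\<close>
    have "t = t'"
    proof (rule ccontr)
      assume "t \<noteq> t'"
      then have u: "t \<ominus> t' \<in> Units R"
        using t by (simp add: field_Units)
      have "(t \<ominus> t') \<odot>\<^bsub>M\<^esub> v = h' \<ominus>\<^bsub>M\<^esub> h"
      proof -
        have "(t \<ominus> t') \<odot>\<^bsub>M\<^esub> v = t \<odot>\<^bsub>M\<^esub> v \<ominus>\<^bsub>M\<^esub> t' \<odot>\<^bsub>M\<^esub> v"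
          using t by (simp add: a_minus_def M.smult_l_distr M.smult_l_minus)
        \<comment> \<open>The same \<open>h\<close> is added to both terms so that \<open>eq\<close>
          can rewrite the first sum; then the multiples of \<open>v\<close> cancel.\<close>
        also have "\<dots> = (t \<odot>\<^bsub>M\<^esub> v \<oplus>\<^bsub>M\<^esub> h) \<ominus>\<^bsub>M\<^esub> (t' \<odot>\<^bsub>M\<^esub> v \<oplus>\<^bsub>M\<^esub> h)"
          using t h HM by (simp add: a_minus_def M.minus_add M.a_ac M.r_neg M.r_neg2)
        also have "\<dots> = h' \<ominus>\<^bsub>M\<^esub> h"
          using t h HM by (simp add: eq a_minus_def M.minus_add M.a_ac M.r_neg M.r_neg2)
        finally show ?thesis .
      qed
      \<comment> \<open>Negation is read as multiplication by minus one, which a submodule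
        admits.\<close>
      also have "\<dots> \<in> H"
        using h by (simp add: a_minus_def HM flip: M.smult_minus_1)
      finally have "(t \<ominus> t') \<odot>\<^bsub>M\<^esub> v \<in> H" .
      from H.smult_closed [OF Units_inv_closed [OF u] this]
      have "inv (t \<ominus> t') \<odot>\<^bsub>M\<^esub> ((t \<ominus> t') \<odot>\<^bsub>M\<^esub> v) \<in> H" .
      moreover have "inv (t \<ominus> t') \<odot>\<^bsub>M\<^esub> ((t \<ominus> t') \<odot>\<^bsub>M\<^esub> v) = v"
        using u t by (subst M.smult_assoc1 [symmetric]) auto
      ultimately have "v \<in> H"
        by simp
      with v show False by blast
    qed
    with eq show "t = t' \<and> h = h'"
      using t h by (simp add: HM)
  qed
  moreover have "(\<lambda>(t, h). t \<odot>\<^bsub>M\<^esub> v \<oplus>\<^bsub>M\<^esub> h) ` (carrier R \<times> H) \<subseteq> V"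
    using v \<open>H \<subset> V\<close> by auto
  ultimately have "card (carrier R \<times> H) \<le> card V"
    using fin by (intro card_inj_on_le)
  then show ?thesis by (simp add: card_cartesian_product)
qed

text \<open>A matrix with a single nonzero column suffices: over a field, a nonzero coordinate of
  \<open>u\<close> can be divided out, and the column is a multiple of \<open>w\<close>, hence in
  the kernel of \<open>X\<close>.\<close>

lemma ex_annihilator_with_value:
  assumes X: "X \<in> carrier (matrix_space R r k)"
    and u: "u \<in> carrier (coord_space R c)" "u \<noteq> \<zero>\<^bsub>coord_space R c\<^esub>"
    and w: "w \<in> mod_hom.ker (coord_space R k) (coord_space R r) (matrix_map R r k X)"
  shows "\<exists>Z\<in>annihilators r k c X. matrix_map R k c Z u = w"
proof -
  obtain j where j: "j < c" "u j \<noteq> \<zero>"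
    using u by (auto simp: fun_eq_iff PiE_def extensional_def restrict_def split: if_splits)
  have w': "w \<in> carrier (coord_space R k)" "matrix_map R r k X w = \<zero>\<^bsub>coord_space R r\<^esub>"
    using w by (auto simp: ker_matrix_map [OF X])
  have [simp]: "X (i, l) \<in> carrier R" if "i < r" "l < k" for i l
    using X that by auto
  have [simp]: "w i \<in> carrier R" if "i < k" for i
    using w' that by auto
  have uR [simp]: "u i \<in> carrier R" if "i < c" for i
    using u that by auto
  have inv_u [simp]: "inv u j \<in> carrier R" "inv u j \<otimes> u j = \<one>"
    using j uR [OF j(1)] by (simp_all add: field_Units)
  \<comment> \<open>Column \<open>j\<close> is \<open>w\<close> divided by \<open>u j\<close>, so
    only coordinate \<open>j\<close> of \<open>u\<close> contributes to Z u, and the result is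
    \<open>w\<close>.\<close>
  define Z where "Z = (\<lambda>(i, l)\<in>{..<k} \<times> {..<c}. if l = j then w i \<otimes> inv u j else \<zero>)"
  have "Z \<in> carrier (matrix_space R k c)"
    by (auto simp: Z_def)
  moreover have "matrix_mult R r k c X Z = \<zero>\<^bsub>matrix_space R r c\<^esub>"
  proof -
    have "(\<Oplus>a\<in>{..<k}. X (i, a) \<otimes> (if l = j then w a \<otimes> inv u j else \<zero>)) = \<zero>"
      if "i < r" "l < c" for i l
    proof (cases "l = j")
      case True
      have "(\<Oplus>a\<in>{..<k}. X (i, a) \<otimes> w a \<otimes> inv u j) = (\<Oplus>a\<in>{..<k}. X (i, a) \<otimes> w a) \<otimes> inv u j"
        using that by (subst finsum_ldistr) auto
      also have "(\<Oplus>a\<in>{..<k}. X (i, a) \<otimes> w a) = \<zero>"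
        using fun_cong [OF w'(2), of i] that by (simp add: matrix_map_def)
      finally show ?thesis
        using that True by (simp add: m_assoc cong: finsum_cong_strong)
    next
      case False
      then show ?thesis
        using that by (intro add.finprod_one_eqI) auto
    qed
    then show ?thesis
      by (auto simp: matrix_mult_def Z_def fun_eq_iff restrict_def cong: finsum_cong_strong)
  qed
  moreover have "matrix_map R k c Z u = w"
  proof -
    have "(\<Oplus>l\<in>{..<c}. (if l = j then w i \<otimes> inv u j else \<zero>) \<otimes> u l) = w i" if "i < k" for i
    proof -
      have "(\<Oplus>l\<in>{..<c}. (if l = j then w i \<otimes> inv u j else \<zero>) \<otimes> u l)
          = (\<Oplus>l\<in>{..<c}. if j = l then w i else \<zero>)"
        using that j by (intro finsum_cong') (auto simp: m_assoc)
      also have "\<dots> = w i"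
        using that j by (intro finsum_singleton) auto
      finally show ?thesis .
    qed
    \<comment> \<open>Vectors are extensional, so equality with \<open>w\<close> must also hold
      outside the index range.\<close>
    moreover have "w i = undefined" if "\<not> i < k" for i
      using w'(1) that by auto
    ultimately show ?thesis
      by (intro ext) (simp add: matrix_map_def Z_def restrict_def cong: finsum_cong_strong)
  qed
  ultimately show ?thesis
    by (auto simp: annihilators_def)
qed


text \<open>The fibres of evaluation at \<open>u\<close> over the points of the kernel partition the
  annihilators, and translation shows that none is smaller than the fibre over zero.\<close>

lemma card_annihilators_vanishing:
  assumes X: "X \<in> carrier (matrix_space R r k)" and fin: "finite (carrier R)"
    and u: "u \<in> carrier (coord_space R c)" "u \<noteq> \<zero>\<^bsub>coord_space R c\<^esub>"
  shows "card {Y \<in> annihilators r k c X. matrix_map R k c Y u = \<zero>\<^bsub>coord_space R k\<^esub>}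
      * card (mod_hom.ker (coord_space R k) (coord_space R r) (matrix_map R r k X))
    \<le> card (annihilators r k c X)"
proof -
  define W V where "W = annihilators r k c X"
    and "V = mod_hom.ker (coord_space R k) (coord_space R r) (matrix_map R r k X)"
  define e where "e Y = matrix_map R k c Y u" for Y
  interpret K: mod_hom R "coord_space R k" "coord_space R r" "matrix_map R r k X"
    by (rule matrix_map_mod_hom [OF X])
  interpret MS: module R "matrix_space R k c"
    by (rule func_space_is_module)
  have W: "W \<subseteq> carrier (matrix_space R k c)"
    by (auto simp: W_def annihilators_def)
  then have finW: "finite W"
    by (rule finite_subset) (auto intro!: finite_PiE fin)
  have V: "V \<subseteq> carrier (coord_space R k)"
    unfolding V_def by (auto simp: K.ker_def)
  then have finV: "finite V"
    by (rule finite_subset) (auto intro!: finite_PiE fin)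
  have eV: "e ` W \<subseteq> V"
  proof (rule image_subsetI)
    fix Y assume Y: "Y \<in> W"
    then have "e Y \<in> mod_hom.im (coord_space R c) (matrix_map R k c Y)"
      using W u(1) by (subst im_matrix_map) (blast, simp only: e_def imageI)
    then show "e Y \<in> V"
      using annihilators_im_subset_ker [OF X] Y unfolding W_def V_def by blast
  qed
  have "card {Y \<in> W. e Y = \<zero>\<^bsub>coord_space R k\<^esub>} \<le> card {Y \<in> W. e Y = w}" if w: "w \<in> V" for w
  \<comment> \<open>Adding an annihilator \<open>Z\<close> with value \<open>w\<close> at
    \<open>u\<close> moves the fibre over zero injectively into the fibre over
    \<open>w\<close>.\<close>
  proof -
    obtain Z where Z: "Z \<in> W" "e Z = w"
      using ex_annihilator_with_value [OF X u] w by (auto simp: W_def V_def e_def)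
    show ?thesis
    proof (rule card_inj_on_le)
      show "inj_on (\<lambda>Y. Y \<oplus>\<^bsub>matrix_space R k c\<^esub> Z) {Y \<in> W. e Y = \<zero>\<^bsub>coord_space R k\<^esub>}"
      proof (rule inj_onI)
        fix Y Y' assume "Y \<in> {Y \<in> W. e Y = \<zero>\<^bsub>coord_space R k\<^esub>}"
          and "Y' \<in> {Y \<in> W. e Y = \<zero>\<^bsub>coord_space R k\<^esub>}"
        then have "Y \<in> carrier (matrix_space R k c)" "Y' \<in> carrier (matrix_space R k c)"
          and "Z \<in> carrier (matrix_space R k c)"
          using W Z by blast+
        then show "Y = Y'"
          if "Y \<oplus>\<^bsub>matrix_space R k c\<^esub> Z = Y' \<oplus>\<^bsub>matrix_space R k c\<^esub> Z"
          using MS.add.right_cancel that by blast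
      qed
      show "(\<lambda>Y. Y \<oplus>\<^bsub>matrix_space R k c\<^esub> Z) ` {Y \<in> W. e Y = \<zero>\<^bsub>coord_space R k\<^esub>}
        \<subseteq> {Y \<in> W. e Y = w}"
      proof safe
        fix Y assume Y: "Y \<in> W" "e Y = \<zero>\<^bsub>coord_space R k\<^esub>"
        show "Y \<oplus>\<^bsub>matrix_space R k c\<^esub> Z \<in> W"
          using annihilators_add [OF X] Y Z by (simp add: W_def)
        have "e (Y \<oplus>\<^bsub>matrix_space R k c\<^esub> Z) = e Y \<oplus>\<^bsub>coord_space R k\<^esub> e Z"
          unfolding e_def using Y Z W u by (intro matrix_map_add) auto
        also have "\<dots> = w"
          unfolding Y Z using w V by (intro K.M.M.l_zero) auto
        finally show "e (Y \<oplus>\<^bsub>matrix_space R k c\<^esub> Z) = w" .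
      qed
      show "finite {Y \<in> W. e Y = w}"
        using finW by simp
    qed
  qed
  then have "(\<Sum>w\<in>V. card {Y \<in> W. e Y = \<zero>\<^bsub>coord_space R k\<^esub>}) \<le> (\<Sum>w\<in>V. card {Y \<in> W. e Y = w})"
    by (rule sum_mono)
  also have "\<dots> = card W"
    using sum.group [OF finW finV eV, of "\<lambda>_. 1::nat"] by simp
  finally show ?thesis
    by (simp add: W_def V_def e_def mult.commute)
qed

text \<open>Division-free form of the bound 1 / (q - 1) on the proportion of non-exact matrices. The
  hypothesis \<open>k \<le> c\<close> enters through the estimate of \<open>card V\<close> by
  \<open>T\<close>, the number of vectors of length \<open>c\<close>.\<close>

lemma card_non_exact_annihilators:
  assumes X: "X \<in> carrier (matrix_space R r k)" and fin: "finite (carrier R)" and "k \<le> c"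
  shows "card {Y \<in> annihilators r k c X. mod_hom.im (coord_space R c) (matrix_map R k c Y)
        \<noteq> mod_hom.ker (coord_space R k) (coord_space R r) (matrix_map R r k X)}
      * (card (carrier R) - 1) \<le> card (annihilators r k c X)"
proof -
  define W V where "W = annihilators r k c X"
    and "V = mod_hom.ker (coord_space R k) (coord_space R r) (matrix_map R r k X)"
  define U where "U = carrier (coord_space R c)"
  define q where "q = card (carrier R)"
  define T where "T = q ^ c"
  define im ker where "im Y = mod_hom.im (coord_space R c) (matrix_map R k c Y)"
    and "ker Y = mod_hom.ker (coord_space R c) (coord_space R k) (matrix_map R k c Y)" for Y
  define B where "B = {Y \<in> W. im Y \<noteq> V}"
  interpret K: mod_hom R "coord_space R k" "coord_space R r" "matrix_map R r k X"
    by (rule matrix_map_mod_hom [OF X])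
  have W: "W \<subseteq> carrier (matrix_space R k c)"
    by (auto simp: W_def annihilators_def)
  then have finW: "finite W"
    by (rule finite_subset) (auto intro!: finite_PiE fin)
  have V: "V \<subseteq> carrier (coord_space R k)"
    unfolding V_def by (auto simp: K.ker_def)
  then have finV: "finite V"
    by (rule finite_subset) (auto intro!: finite_PiE fin)
  have finU: "finite U"
    unfolding U_def by (auto intro!: finite_PiE fin)
  have q: "1 \<le> q"
    using fin card_gt_0_iff [of "carrier R"] by (auto simp: q_def Suc_le_eq)
  have T: "card U = T"
    by (simp add: U_def T_def q_def card_PiE)
  have "card V \<le> q ^ k"
    using card_mono [OF _ V] by (simp add: q_def card_PiE finite_PiE fin)
  also have "\<dots> \<le> T"
    unfolding T_def using q \<open>k \<le> c\<close> by (intro power_increasing)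
  finally have VT: "card V \<le> T" .
  have T0: "0 < T"
    using q by (simp add: T_def)
  have z: "\<zero>\<^bsub>coord_space R c\<^esub> \<in> U"
    by (auto simp: U_def)

  have ker: "ker Y = {u \<in> U. matrix_map R k c Y u = \<zero>\<^bsub>coord_space R k\<^esub>}" if "Y \<in> W" for Y
    using that W unfolding ker_def U_def by (intro ker_matrix_map) auto
  \<comment> \<open>Double counting of the pairs \<open>(Y, u)\<close> for which \<open>Y\<close>
    maps \<open>u\<close> to zero.\<close>
  have "(\<Sum>Y\<in>W. card (ker Y))
      = (\<Sum>Y\<in>W. \<Sum>u\<in>U. if matrix_map R k c Y u = \<zero>\<^bsub>coord_space R k\<^esub> then 1 else 0)"
    using finU by (intro sum.cong) (simp_all add: ker flip: sum.inter_filter)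
  also have "\<dots> = (\<Sum>u\<in>U. \<Sum>Y\<in>W. if matrix_map R k c Y u = \<zero>\<^bsub>coord_space R k\<^esub> then 1 else 0)"
    by (rule sum.swap)
  also have "\<dots> = (\<Sum>u\<in>U. card {Y \<in> W. matrix_map R k c Y u = \<zero>\<^bsub>coord_space R k\<^esub>})"
    using finW by (intro sum.cong) (simp_all flip: sum.inter_filter)
  finally have "card V * (\<Sum>Y\<in>W. card (ker Y))
      = (\<Sum>u\<in>U. card {Y \<in> W. matrix_map R k c Y u = \<zero>\<^bsub>coord_space R k\<^esub>} * card V)"
    by (simp add: sum_distrib_left mult.commute)
  \<comment> \<open>The zero vector is killed by all of \<open>W\<close>; every other vector is
    covered by \<open>card_annihilators_vanishing\<close>.\<close>
  also have "\<dots> \<le> (\<Sum>u\<in>U. if u = \<zero>\<^bsub>coord_space R c\<^esub> then card W * card V else card W)"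
  proof (rule sum_mono)
    fix u assume u: "u \<in> U"
    have "card {Y \<in> W. matrix_map R k c Y u = \<zero>\<^bsub>coord_space R k\<^esub>} \<le> card W"
      using finW by (intro card_mono) auto
    then show "card {Y \<in> W. matrix_map R k c Y u = \<zero>\<^bsub>coord_space R k\<^esub>} * card V
      \<le> (if u = \<zero>\<^bsub>coord_space R c\<^esub> then card W * card V else card W)"
      using card_annihilators_vanishing [OF X fin, of u c] u by (auto simp: W_def V_def U_def)
  qed
  also have "\<dots> = card V * card W + (T - 1) * card W"
    using finU z T by (subst sum.remove [OF finU z]) (simp add: card_Diff_singleton mult.commute)
  finally have upper: "card V * (\<Sum>Y\<in>W. card (ker Y)) \<le> card V * card W + (T - 1) * card W" .

  \<comment> \<open>The kernel bound is multiplied by \<open>card V\<close> to avoid division. For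
    \<open>Y\<close> in \<open>B\<close> the image is proper in \<open>V\<close>, which gains a
    factor \<open>q\<close>; it is written as T + (q - 1) T so that the excess can be summed
    separately.\<close>
  have lower: "T + (if Y \<in> B then (q - 1) * T else 0) \<le> card V * card (ker Y)" if Y: "Y \<in> W" for Y
  proof -
    interpret Y: mod_hom R "coord_space R c" "coord_space R k" "matrix_map R k c Y"
      using Y W by (intro matrix_map_mod_hom) auto
    have T_le: "T \<le> card (ker Y) * card (im Y)"
      using Y.card_le_card_ker_times_card_im finU T by (simp add: U_def im_def ker_def)
    show ?thesis
    proof (cases "Y \<in> B")
      case True
      then have "im Y \<subset> V"
        using annihilators_im_subset_ker [OF X] Y by (auto simp: B_def W_def V_def im_def)
      then have "q * card (im Y) \<le> card V"
        using card_proper_submodule [OF _ _ _ finV] Y.im_is_submodule K.ker_is_submodule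
        unfolding q_def im_def V_def by blast
      then have "q * card (im Y) * card (ker Y) \<le> card V * card (ker Y)"
        by (rule mult_right_mono) simp
      moreover have "T + (q - 1) * T = q * T"
        using q by (cases q) auto
      moreover have "q * T \<le> q * card (im Y) * card (ker Y)"
        using T_le by (simp add: mult_ac)
      ultimately show ?thesis
        using True by (metis (full_types) order_trans)
    next
      case False
      then show ?thesis
        using T_le Y by (simp add: B_def mult.commute)
    qed
  qed
  have "card W * T + card B * ((q - 1) * T) = (\<Sum>Y\<in>W. T + (if Y \<in> B then (q - 1) * T else 0))"
    using finW by (simp add: sum.distrib B_def flip: sum.inter_filter)
  also have "\<dots> \<le> card V * (\<Sum>Y\<in>W. card (ker Y))"
    unfolding sum_distrib_left using lower by (rule sum_mono)
  also note upper
  \<comment> \<open>With \<open>card V\<close> and \<open>T - 1\<close> both bounded by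
    \<open>T\<close>, one copy of \<open>T * card W\<close> cancels against the left side and only
    the excess from \<open>B\<close> remains.\<close>
  also have "card V * card W + (T - 1) * card W \<le> T * card W + T * card W"
    using VT by (intro add_mono mult_right_mono) auto
  finally have "card B * (q - 1) * T \<le> card W * T"
    by (simp add: algebra_simps)
  then show ?thesis
    using T0 by (simp add: B_def W_def V_def im_def q_def)
qed

end

section \<open>From exactness of fixed matrices to probabilities\<close>

text \<open>Once image and kernel agree as sets, nullity and rank are \<open>dim\<close> of
  literally the same module, so no dimension has to be computed.\<close>

lemma betti_eq_0I:
  assumes "mod_hom.im (coord_space K (n (Suc m))) (matrix_map K (n m) (n (Suc m)) (X (Suc m)))
    = mod_hom.ker (coord_space K (n m)) (coord_space K (target_dim n m))
        (matrix_map K (target_dim n m) (n m) (X m))"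
  shows "betti K n X m = 0"
  using assms by (simp add: betti_def matrix_nullity_def matrix_rank_def)

context uniform_random_chain_complex
begin

text \<open>The two matrices are arguments so that the first can be frozen at a value of the past
  while the second stays random.\<close>

definition exact :: "nat \<Rightarrow> (nat \<times> nat \<Rightarrow> int) \<Rightarrow> (nat \<times> nat \<Rightarrow> int) \<Rightarrow> bool" where
  "exact m X Y \<longleftrightarrow> mod_hom.im (coord_space (residue_ring (int q)) (n (Suc m)))
      (matrix_map (residue_ring (int q)) (n m) (n (Suc m)) Y)
    = mod_hom.ker (coord_space (residue_ring (int q)) (n m))
        (coord_space (residue_ring (int q)) (target_dim n m))
        (matrix_map (residue_ring (int q)) (target_dim n m) (n m) X)"

abbreviation matrices :: "nat \<Rightarrow> (nat \<times> nat \<Rightarrow> int) set" where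
  "matrices i \<equiv> carrier (matrix_space (residue_ring (int q)) (target_dim n i) (n i))"

lemma field_residue_ring: "field (residue_ring (int q))"
  using residues_prime.is_field [OF residues_prime.intro [OF prime_q]] .

lemma finite_residue_ring: "finite (carrier (residue_ring (int q)))"
  by (simp add: residue_ring_def)

lemma finite_matrices: "finite (matrices i)"
proof -
  interpret field "residue_ring (int q)" by (rule field_residue_ring)
  show ?thesis by (auto intro!: finite_PiE finite_residue_ring)
qed

lemma A_in_matrices: "\<omega> \<in> space M \<Longrightarrow> A i \<omega> \<in> matrices i"
  using measurable_space [OF random_matrix, of \<omega> i] by simp

text \<open>\<open>A i\<close> is measurable into a count space, where every set of matrices is
  measurable; hence \<open>P\<close> is arbitrary.\<close>

lemma A_event: "{\<omega> \<in> space M. P (A i \<omega>)} \<in> events"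
proof -
  have "{\<omega> \<in> space M. P (A i \<omega>)} = A i -` (Collect P \<inter> matrices i) \<inter> space M"
    using A_in_matrices by auto
  also have "\<dots> \<in> events"
    by (rule measurable_sets [OF random_matrix]) auto
  finally show ?thesis .
qed

lemma history_event: "{\<omega> \<in> space M. \<forall>i\<le>m. A i \<omega> = a i} \<in> events"
proof -
  have "{\<omega> \<in> space M. \<forall>i\<in>{..m}. A i \<omega> = a i} \<in> events"
  proof (rule sets.sets_Collect_finite_All)
    show "{\<omega> \<in> space M. A i \<omega> = a i} \<in> events" for i
      by (rule A_event)
  qed simp
  then show ?thesis by (simp only: Ball_def atMost_iff)
qed

text \<open>The event is a finite union over the values of the first matrix. It is used for the
  Betti number, which depends on two consecutive matrices.\<close>

lemma A_pair_event: "{\<omega> \<in> space M. P (A i \<omega>) (A j \<omega>)} \<in> events"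
proof -
  have "{\<omega> \<in> space M. P (A i \<omega>) (A j \<omega>)}
      = (\<Union>x\<in>matrices i. {\<omega> \<in> space M. A i \<omega> = x} \<inter> {\<omega> \<in> space M. P x (A j \<omega>)})"
    using A_in_matrices by auto
  also have "\<dots> \<in> events"
    by (intro sets.finite_UN finite_matrices sets.Int A_event)
  finally show ?thesis .
qed

lemma card_exact_annihilated:
  assumes X: "X \<in> matrices m" and le: "n m \<le> n (Suc m)"
  defines "W \<equiv> annihilated_matrices (residue_ring (int q)) n m X"
  shows "finite W" "W \<noteq> {}" "real (card {Y \<in> W. exact m X Y}) / real (card W) \<ge> 1 - 1 / (real q - 1)"
proof -
  interpret field "residue_ring (int q)" by (rule field_residue_ring)
  have W: "W = annihilators (target_dim n m) (n m) (n (Suc m)) X"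
    by (simp add: W_def annihilated_matrices_def annihilators_def)
  show "finite W"
    using finite_subset [OF _ finite_matrices [of "Suc m"], of W]
    by (auto simp: W annihilators_def target_dim_def)
  show "W \<noteq> {}"
    using zero_in_annihilators [OF X] unfolding W by blast
  have q: "1 < q" "card (carrier (residue_ring (int q))) = q"
    using prime_gt_1_nat [OF prime_q] by (simp_all add: residue_ring_def)
  have "card {Y \<in> W. \<not> exact m X Y} * (q - 1) \<le> card W"
    using card_non_exact_annihilators [OF X finite_residue_ring le] q
    by (simp add: W exact_def)
  then have "real (card {Y \<in> W. \<not> exact m X Y}) * (real q - 1) \<le> real (card W)"
    using q(1) by (simp only: of_nat_le_iff [where 'a = real, symmetric] of_nat_mult of_nat_diff of_nat_1)
  moreover have W0: "real (card W) > 0"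
    using \<open>finite W\<close> \<open>W \<noteq> {}\<close> by (simp add: card_gt_0_iff)
  \<comment> \<open>Primality gives q > 1, so both divisors, \<open>real q - 1\<close> and
    \<open>card W\<close>, are positive.\<close>
  ultimately have "real (card {Y \<in> W. \<not> exact m X Y}) / real (card W) \<le> 1 / (real q - 1)"
    using q(1) by (simp add: divide_le_eq le_divide_eq mult.commute)
  moreover have "card W = card {Y \<in> W. exact m X Y} + card {Y \<in> W. \<not> exact m X Y}"
    using \<open>finite W\<close> by (subst card_Un_disjoint [symmetric]) (auto intro!: arg_cong [of _ _ card])
  then have "real (card {Y \<in> W. exact m X Y}) = real (card W) - real (card {Y \<in> W. \<not> exact m X Y})"
    by linarith
  ultimately show "real (card {Y \<in> W. exact m X Y}) / real (card W) \<ge> 1 - 1 / (real q - 1)"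
    using W0 by (simp add: diff_divide_distrib)
qed

text \<open>Stated with joint instead of conditional probabilities, so that it also holds trivially
  for histories of probability zero.\<close>

lemma prob_exact_given_history:
  assumes a: "a m \<in> matrices m" and le: "n m \<le> n (Suc m)"
  shows "(1 - 1 / (real q - 1)) * \<P>(\<omega> in M. \<forall>i\<le>m. A i \<omega> = a i)
    \<le> \<P>(\<omega> in M. exact m (a m) (A (Suc m) \<omega>) \<and> (\<forall>i\<le>m. A i \<omega> = a i))"
proof (cases "\<P>(\<omega> in M. \<forall>i\<le>m. A i \<omega> = a i) = 0")
  case False
  then have pos: "\<P>(\<omega> in M. \<forall>i\<le>m. A i \<omega> = a i) > 0"
    using measure_nonneg [of M] by (simp add: less_le)
  define W where "W = annihilated_matrices (residue_ring (int q)) n m (a m)"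
  define G where "G = {Y \<in> W. exact m (a m) Y}"
  note W = card_exact_annihilated [OF a le, folded W_def, folded G_def]
  \<comment> \<open>Uniformity gives each member of the finite nonempty set \<open>W\<close>
    conditional probability 1 / \<open>card W\<close>; multiplying by the probability of the history
    gives the joint one.\<close>
  have b: "\<P>(\<omega> in M. A (Suc m) \<omega> = b \<and> (\<forall>i\<le>m. A i \<omega> = a i))
      = \<P>(\<omega> in M. \<forall>i\<le>m. A i \<omega> = a i) / card W" if "b \<in> G" for b
    using uniform [OF pos, of b] pos that W
    by (simp add: cond_prob_def W_def [symmetric] G_def field_simps)
  have "(1 - 1 / (real q - 1)) * \<P>(\<omega> in M. \<forall>i\<le>m. A i \<omega> = a i)
      \<le> (card G / card W) * \<P>(\<omega> in M. \<forall>i\<le>m. A i \<omega> = a i)"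
    using W pos by (intro mult_right_mono) auto
  also have "\<dots> = (\<Sum>b\<in>G. \<P>(\<omega> in M. A (Suc m) \<omega> = b \<and> (\<forall>i\<le>m. A i \<omega> = a i)))"
    by (simp add: b)
  also have "\<dots> = prob (\<Union>b\<in>G. {\<omega> \<in> space M. A (Suc m) \<omega> = b \<and> (\<forall>i\<le>m. A i \<omega> = a i)})"
  proof (rule finite_measure_finite_Union [symmetric])
    show "finite G" using W by (simp add: G_def)
    have "{\<omega> \<in> space M. A (Suc m) \<omega> = b \<and> (\<forall>i\<le>m. A i \<omega> = a i)} \<in> events" for b
      by (intro sets.sets_Collect_conj history_event A_event [of "\<lambda>Y. Y = b"])
    then show "(\<lambda>b. {\<omega> \<in> space M. A (Suc m) \<omega> = b \<and> (\<forall>i\<le>m. A i \<omega> = a i)}) ` G \<subseteq> events"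
      by blast
  qed (auto simp: disjoint_family_on_def)
  also have "\<dots> \<le> \<P>(\<omega> in M. exact m (a m) (A (Suc m) \<omega>) \<and> (\<forall>i\<le>m. A i \<omega> = a i))"
  proof (rule finite_measure_mono)
    show "{\<omega> \<in> space M. exact m (a m) (A (Suc m) \<omega>) \<and> (\<forall>i\<le>m. A i \<omega> = a i)} \<in> events"
      by (intro sets.sets_Collect_conj history_event A_event)
  qed (auto simp: G_def)
  finally show ?thesis .
qed simp

text \<open>Total probability over the finitely many histories up to \<open>m\<close>: the bound on
  the conditional probability is the same for each of them.\<close>

lemma prob_betti_eq_0:
  assumes le: "n m \<le> n (Suc m)"
  shows "1 - 1 / (real q - 1) \<le> \<P>(\<omega> in M. betti (residue_ring (int q)) n (\<lambda>i. A i \<omega>) m = 0)"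
proof -
  \<comment> \<open>Histories are extensional on \<open>{..m}\<close>, so distinct ones differ at
    some index up to \<open>m\<close> and the events \<open>E a\<close> are disjoint.\<close>
  define H where "H = (\<Pi>\<^sub>E i\<in>{..m}. matrices i)"
  define E where "E a = {\<omega> \<in> space M. \<forall>i\<le>m. A i \<omega> = a i}" for a
  define F where "F a = {\<omega> \<in> space M. exact m (a m) (A (Suc m) \<omega>) \<and> (\<forall>i\<le>m. A i \<omega> = a i)}" for a
  have finH: "finite H"
    unfolding H_def by (intro finite_PiE finite_matrices) auto
  have E: "E a \<in> events" for a
    unfolding E_def by (rule history_event)
  have F: "F a \<in> events" for a
    unfolding F_def by (intro sets.sets_Collect_conj history_event A_event)
  have disj: "disjoint_family_on E H"
    unfolding disjoint_family_on_def
  proof safe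
    fix a b \<omega> assume ab: "a \<in> H" "b \<in> H" "a \<noteq> b" and "\<omega> \<in> E a" "\<omega> \<in> E b"
    then have "a = b"
      unfolding H_def by (intro PiE_ext [of a _ _ b]) (auto simp: E_def)
    with ab show "\<omega> \<in> {}" by simp
  qed
  have "space M = (\<Union>a\<in>H. E a)"
  proof safe
    fix \<omega> assume "\<omega> \<in> space M"
    then show "\<omega> \<in> (\<Union>a\<in>H. E a)"
      using A_in_matrices
      by (intro UN_I [of "\<lambda>i\<in>{..m}. A i \<omega>"]) (auto simp: H_def E_def)
  qed (auto simp: E_def)
  then have "1 = (\<Sum>a\<in>H. prob (E a))"
    using finite_measure_finite_Union [OF finH _ disj] E prob_space by auto
  then have "1 - 1 / (real q - 1) = (\<Sum>a\<in>H. (1 - 1 / (real q - 1)) * prob (E a))"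
    by (metis mult.right_neutral sum_distrib_left)
  also have "\<dots> \<le> (\<Sum>a\<in>H. prob (F a))"
    unfolding E_def F_def using le
    by (intro sum_mono prob_exact_given_history) (auto simp: H_def)
  \<comment> \<open>Each \<open>F a\<close> lies in \<open>E a\<close>, so disjointness is
    inherited.\<close>
  also have "\<dots> = prob (\<Union>a\<in>H. F a)"
    using F disj
    by (intro finite_measure_finite_Union [symmetric] finH) (auto simp: disjoint_family_on_def E_def F_def)
  also have "\<dots> \<le> \<P>(\<omega> in M. betti (residue_ring (int q)) n (\<lambda>i. A i \<omega>) m = 0)"
  proof (rule finite_measure_mono)
    show "(\<Union>a\<in>H. F a) \<subseteq> {\<omega> \<in> space M. betti (residue_ring (int q)) n (\<lambda>i. A i \<omega>) m = 0}"
    proof safe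
      fix a \<omega> assume "\<omega> \<in> F a"
      then show "betti (residue_ring (int q)) n (\<lambda>i. A i \<omega>) m = 0" and "\<omega> \<in> space M"
        by (auto simp: F_def exact_def intro!: betti_eq_0I)
    qed
    show "{\<omega> \<in> space M. betti (residue_ring (int q)) n (\<lambda>i. A i \<omega>) m = 0} \<in> events"
      unfolding betti_def by (rule A_pair_event)
  qed
  finally show ?thesis .
qed

end

section \<open>The limit over the primes\<close>

theorem corollary4p3:
  fixes n :: "nat \<Rightarrow> nat"
    and M :: "nat \<Rightarrow> 'w measure"
    and A :: "nat \<Rightarrow> nat \<Rightarrow> 'w \<Rightarrow> nat \<times> nat \<Rightarrow> int"
    and m :: nat
  assumes "mono n"
    and "\<And>q. prime q \<Longrightarrow> uniform_random_chain_complex q n (M q) (A q)"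
  shows "((\<lambda>q. \<P>(\<omega> in M q. betti (residue_ring (int q)) n (\<lambda>i. A q i \<omega>) m = 0)) \<longlongrightarrow> 1)
           (inf at_top (principal {q. prime q}))"
proof (rule tendsto_sandwich)
  have le: "n m \<le> n (Suc m)"
    using \<open>mono n\<close> by (rule monoD) simp
  show "\<forall>\<^sub>F q in inf at_top (principal {q. prime q}). 1 - 1 / (real q - 1)
      \<le> \<P>(\<omega> in M q. betti (residue_ring (int q)) n (\<lambda>i. A q i \<omega>) m = 0)"
    unfolding eventually_inf_principal
    using uniform_random_chain_complex.prob_betti_eq_0 [where m = m, OF assms(2) le]
    by (auto intro!: always_eventually)
  show "\<forall>\<^sub>F q in inf at_top (principal {q. prime q}).
      \<P>(\<omega> in M q. betti (residue_ring (int q)) n (\<lambda>i. A q i \<omega>) m = 0) \<le> 1"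
    unfolding eventually_inf_principal
    using prob_space.prob_le_1 [OF uniform_random_chain_complex.axioms(1) [OF assms(2)]]
    by (auto intro!: always_eventually)
  \<comment> \<open>The lower bound tends to 1 along all natural numbers, hence along the finer
    filter of large primes; the upper bound is the constant 1.\<close>
  have "((\<lambda>q. 1 - 1 / (real q - 1)) \<longlongrightarrow> 1) at_top"
    by real_asymp
  then show "((\<lambda>q. 1 - 1 / (real q - 1)) \<longlongrightarrow> 1) (inf at_top (principal {q. prime q}))"
    by (rule tendsto_mono [rotated]) simp
qed simp

end
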